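(* There exists a goods instance with two agents and normalized additive valuations for which no randomized allocation is both ex-ante EQ and ex-post EFX.
   Context: An instance consists of agents $N=\{1,\dots,n\}$, a finite set $M$ of indivisible items, and for each agent $i$ an additive valuation $v_i:2^M\to\mathbb{R}$, i.e. $v_i(\emptyset)=0$ and $v_i(S)=\sum_{o\in S}v_i(o)$. It is a goods instance if $v_i(o)\ge0$ for all $i,o$. It is normalized if $v_i(M)=v_j(M)$ for all $i,j\in N$. An allocation $A=(A_1,\dots,A_n)$ is a partition of $M$ into $n$ pairwise disjoint, possibly empty bundles with union $M$. For goods, $A$ is EFX if for all $i,j\in N$ with $A_j\neq\emptyset$ and every $g\in A_j$ (including goods of value zero), $v_i(A_i)\ge v_i(A_j\setminus\{g\})$. A randomized allocation is a probability distribution over deterministic allocations $A^{(1)},\dots,A^{(k)}$ with probabilities $p_1,\dots,p_k\in[0,1]$, $\sum_\ell p_\ell=1$. It is ex-ante EQ if $\sum_\ell p_\ell v_i(A_i^{(\ell)})=\sum_\ell p_\ell v_j(A_j^{(\ell)})$ for all $i,j\in N$. It satisfies a property ex-post if every allocation in its support satisfies that property. *)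

theory Defs
  imports "HOL-Probability.Probability"
begin

text \<open>The agents are \<open>{1..n}\<close>, the items form a finite set \<open>M\<close>, and \<open>v i S\<close> is the value of agent
  \<open>i\<close> for the bundle \<open>S\<close>. Valuations are only constrained on subsets of \<open>M\<close>.\<close>

definition additive_on :: "'a set \<Rightarrow> ('a set \<Rightarrow> real) \<Rightarrow> bool" where
  "additive_on M w \<longleftrightarrow> w {} = 0 \<and> (\<forall>S\<subseteq>M. w S = (\<Sum>x\<in>S. w {x}))"

definition additive_instance :: "nat \<Rightarrow> 'a set \<Rightarrow> (nat \<Rightarrow> 'a set \<Rightarrow> real) \<Rightarrow> bool" where
  "additive_instance n M v \<longleftrightarrow> finite M \<and> (\<forall>i\<in>{1..n}. additive_on M (v i))"

definition goods_instance :: "nat \<Rightarrow> 'a set \<Rightarrow> (nat \<Rightarrow> 'a set \<Rightarrow> real) \<Rightarrow> bool" where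
  "goods_instance n M v \<longleftrightarrow> additive_instance n M v \<and> (\<forall>i\<in>{1..n}. \<forall>x\<in>M. v i {x} \<ge> 0)"

definition normalized :: "nat \<Rightarrow> 'a set \<Rightarrow> (nat \<Rightarrow> 'a set \<Rightarrow> real) \<Rightarrow> bool" where
  "normalized n M v \<longleftrightarrow> (\<forall>i\<in>{1..n}. \<forall>j\<in>{1..n}. v i M = v j M)"

text \<open>Extensionality makes an allocation the same thing as the tuple of its \<open>n\<close> bundles, so that
  an instance has only finitely many allocations.\<close>

definition allocation :: "nat \<Rightarrow> 'a set \<Rightarrow> (nat \<Rightarrow> 'a set) \<Rightarrow> bool" where
  "allocation n M A \<longleftrightarrow>
     A \<in> extensional {1..n} \<and> disjoint_family_on A {1..n} \<and> (\<Union>i\<in>{1..n}. A i) = M"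

definition EFX :: "nat \<Rightarrow> (nat \<Rightarrow> 'a set \<Rightarrow> real) \<Rightarrow> (nat \<Rightarrow> 'a set) \<Rightarrow> bool" where
  "EFX n v A \<longleftrightarrow>
     (\<forall>i\<in>{1..n}. \<forall>j\<in>{1..n}. A j \<noteq> {} \<longrightarrow> (\<forall>g\<in>A j. v i (A i) \<ge> v i (A j - {g})))"

definition randomized_allocation :: "nat \<Rightarrow> 'a set \<Rightarrow> (nat \<Rightarrow> 'a set) pmf \<Rightarrow> bool" where
  "randomized_allocation n M p \<longleftrightarrow> (\<forall>A\<in>set_pmf p. allocation n M A)"

definition ex_ante_EQ ::
  "nat \<Rightarrow> (nat \<Rightarrow> 'a set \<Rightarrow> real) \<Rightarrow> (nat \<Rightarrow> 'a set) pmf \<Rightarrow> bool" where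
  "ex_ante_EQ n v p \<longleftrightarrow> (\<forall>i\<in>{1..n}. \<forall>j\<in>{1..n}.
     measure_pmf.expectation p (\<lambda>A. v i (A i)) = measure_pmf.expectation p (\<lambda>A. v j (A j)))"

definition ex_post :: "((nat \<Rightarrow> 'a set) \<Rightarrow> bool) \<Rightarrow> (nat \<Rightarrow> 'a set) pmf \<Rightarrow> bool" where
  "ex_post P p \<longleftrightarrow> (\<forall>A\<in>set_pmf p. P A)"

text \<open>A randomized allocation is automatically a finite list of allocations with probabilities, and
  the expectations are the corresponding finite weighted sums.\<close>

lemma finite_set_pmf_randomized_allocation:
  assumes "finite M" "randomized_allocation n M p"
  shows "finite (set_pmf p)"
proof (rule finite_subset)
  show "set_pmf p \<subseteq> PiE {1..n} (\<lambda>_. Pow M)"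
    using assms(2) by (force simp: randomized_allocation_def allocation_def PiE_def)
  show "finite (PiE {1..n} (\<lambda>_. Pow M))"
    using assms(1) by (intro finite_PiE) auto
qed

lemma expectation_randomized_allocation:
  assumes "finite M" "randomized_allocation n M p"
  shows "measure_pmf.expectation p (\<lambda>A. v i (A i)) = (\<Sum>A\<in>set_pmf p. pmf p A * v i (A i))"
  using finite_set_pmf_randomized_allocation[OF assms]
  by (subst integral_measure_pmf_real[where A = "set_pmf p"]) (auto simp: mult.commute)

end

theory Submission imports Defs begin

text \<open>Take four items. Agent 1 values only the item \<open>0\<close>, at \<open>4\<close>, and agent 2 values every item at
  \<open>1\<close>. Agent 1 accepts a bundle without \<open>0\<close> only if agent 2 holds exactly \<open>{0}\<close>, since any further
  item could be removed; but then agent 2 envies the remaining three items even after one is removed.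
  So every EFX allocation gives \<open>0\<close> to agent 1, who gets \<open>4\<close>, while agent 2 gets at most \<open>3\<close>.\<close>

text \<open>The support is finite and nonempty with positive weights, so strictness survives the
  weighted sum.\<close>

lemma expectation_less_of_pointwise_less:
  fixes v :: "nat \<Rightarrow> 'a set \<Rightarrow> real"
  assumes M: "finite M" "randomized_allocation n M p"
    and less: "\<And>A. A \<in> set_pmf p \<Longrightarrow> v i (A i) < v j (A j)"
  shows "measure_pmf.expectation p (\<lambda>A. v i (A i)) < measure_pmf.expectation p (\<lambda>A. v j (A j))"
  unfolding expectation_randomized_allocation[OF M]
  using finite_set_pmf_randomized_allocation[OF M] set_pmf_not_empty less
  by (intro sum_strict_mono) (auto simp: pmf_positive)

text \<open>Three items would not do: giving \<open>0\<close> to agent 2 and the other two to agent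
  1 would be EFX.\<close>

definition items :: "nat set" where
  "items = {0, 1, 2, 3}"

text \<open>The \<open>4\<close> is the number of items, so that the totals agree.\<close>

definition val :: "nat \<Rightarrow> nat set \<Rightarrow> real" where
  "val i S = (if i = 1 then (if 0 \<in> S then 4 else 0) else real (card S))"

lemma goods_instance_val: "goods_instance 2 items val"
proof -
  have "val i S = (\<Sum>x\<in>S. val i {x})" if "S \<subseteq> items" for i S
  proof -
    \<comment> \<open>On an infinite \<open>S\<close> containing \<open>0\<close> the sum would
      default to 0, not 4.\<close>
    have "finite S"
      using that by (rule finite_subset) (simp add: items_def)
    then show ?thesis
      by (cases "i = 1") (simp_all add: val_def)
  qed
  moreover have "finite items" "val i {} = 0" "val i {x} \<ge> 0" for i x
    by (simp_all add: items_def val_def)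
  ultimately show ?thesis
    unfolding goods_instance_def additive_instance_def additive_on_def by blast
qed

lemma normalized_val: "normalized 2 items val"
  by (simp add: normalized_def val_def items_def)

lemma EFX_imp_val_less:
  assumes A: "allocation 2 items A" and efx: "EFX 2 val A"
  shows "val 2 (A 2) < val 1 (A 1)"
proof -
  have two: "{1..2} = {1, 2::nat}"
    by auto
  have union: "A 1 \<union> A 2 = items" and disj: "A 1 \<inter> A 2 = {}"
    using A unfolding allocation_def two disjoint_family_on_def by auto
  have envy: "val i (A i) \<ge> val i (A j - {g})" if "i \<in> {1..2}" "j \<in> {1..2}" "g \<in> A j" for i j g
    using efx that unfolding EFX_def by (metis empty_iff)
  have in1: "0 \<in> A 1"
  proof (rule ccontr)
    assume "0 \<notin> A 1"
    then have "0 \<in> A 2"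
      using union by (auto simp: items_def)
    \<comment> \<open>Removing any other \<open>g\<close> leaves \<open>0\<close> behind, worth 4 to
      agent 1, who has 0.\<close>
    have "g = 0" if "g \<in> A 2" for g
      using envy[of 1 2 g] that \<open>0 \<notin> A 1\<close> \<open>0 \<in> A 2\<close> by (simp add: val_def split: if_splits)
    with \<open>0 \<in> A 2\<close> have "A 2 = {0}"
      by blast
    moreover have "A 1 = items - A 2"
      using union disj by blast
    ultimately have "A 1 = {1, 2, 3}"
      by (auto simp: items_def)
    \<comment> \<open>Removing item \<open>1\<close> leaves \<open>{2, 3}\<close>, worth 2 to agent
      2, whose own \<open>{0}\<close> is worth 1.\<close>
    then show False
      using envy[of 2 1 1] \<open>A 2 = {0}\<close> by (simp add: val_def)
  qed
  then have "A 2 \<subseteq> {1, 2, 3}"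
    using union disj by (auto simp: items_def)
  then have "card (A 2) \<le> card {1, 2, 3 :: nat}"
    by (intro card_mono) auto
  then show ?thesis
    using in1 by (simp add: val_def)
qed

theorem proposition10:
  "\<exists>(M :: nat set) (v :: nat \<Rightarrow> nat set \<Rightarrow> real).
     goods_instance 2 M v \<and> normalized 2 M v \<and>
     \<not> (\<exists>p. randomized_allocation 2 M p \<and> ex_ante_EQ 2 v p \<and> ex_post (EFX 2 v) p)"
proof (intro exI conjI notI; (elim exE conjE)?)
  fix p
  \<comment> \<open>This fixes the witnesses left open by \<open>exI\<close> as \<open>items\<close>
    and \<open>val\<close>.\<close>
  assume p: "randomized_allocation 2 items p" "ex_ante_EQ 2 val p" "ex_post (EFX 2 val) p"
  have "val 2 (A 2) < val 1 (A 1)" if "A \<in> set_pmf p" for A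
    using p that by (intro EFX_imp_val_less) (simp_all add: randomized_allocation_def ex_post_def)
  then have "measure_pmf.expectation p (\<lambda>A. val 2 (A 2)) < measure_pmf.expectation p (\<lambda>A. val 1 (A 1))"
    using p by (intro expectation_less_of_pointwise_less[of items 2]) (auto simp: items_def)
  moreover have "measure_pmf.expectation p (\<lambda>A. val 2 (A 2)) = measure_pmf.expectation p (\<lambda>A. val 1 (A 1))"
    using p by (simp add: ex_ante_EQ_def)
  ultimately show False
    by simp
qed (rule goods_instance_val normalized_val)+

end
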